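(* For $n\geq 2$, $a_n(132;213) = n-1$.
   Context: $\mathcal{S}_n$ is the set of permutations of $[n]=\{1,\dots,n\}$, written in one-line notation $\pi=\pi_1\pi_2\cdots\pi_n$ with $\pi_i=\pi(i)$. A permutation is cyclic if it consists of exactly one $n$-cycle. For a cyclic $\pi$, its standard cycle notation is $C(\pi)=(c_1,c_2,\dots,c_n)$ with $c_1=1$ and $c_i=\pi_{c_{i-1}}$ for $2\le i\le n$. A sequence of distinct integers $w_1\cdots w_m$ contains a pattern $\sigma\in\mathcal{S}_k$ if there are indices $i_1<\dots<i_k$ with $w_{i_1}\cdots w_{i_k}$ in the same relative order as $\sigma_1\cdots\sigma_k$; otherwise it avoids $\sigma$. For $\sigma,\tau\in\mathcal{S}_3$, $\mathcal{A}_n(\sigma;\tau)$ is the set of cyclic permutations $\pi\in\mathcal{S}_n$ whose one-line notation avoids $\sigma$ and whose cycle notation $C(\pi)$ (as the sequence $c_1c_2\cdots c_n$) avoids $\tau$; $a_n(\sigma;\tau)=|\mathcal{A}_n(\sigma;\tau)|$. *)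

theory Defs
  imports "HOL-Combinatorics.Combinatorics"
begin

text \<open>Permutations of \<open>[n] = {1..n}\<close> are functions on \<open>nat\<close> that permute \<open>{1..n}\<close> (and fix
  everything else). One-line notation, cycle notation and patterns are lists of naturals; lists are
  indexed from 0, so entry \<open>i\<close> of the mathematical sequence is entry \<open>i - 1\<close> of the list.\<close>

definition one_line :: "nat \<Rightarrow> (nat \<Rightarrow> nat) \<Rightarrow> nat list" where
  "one_line n \<pi> = map \<pi> [1..<Suc n]"

text \<open>\<open>cyclic_on \<pi> {1..n}\<close> says that \<open>{1..n}\<close> is a single orbit of \<open>\<pi>\<close>.\<close>

definition cyclic_perm :: "nat \<Rightarrow> (nat \<Rightarrow> nat) \<Rightarrow> bool" where
  "cyclic_perm n \<pi> \<longleftrightarrow> \<pi> permutes {1..n} \<and> cyclic_on \<pi> {1..n}"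

text \<open>The standard cycle notation \<open>(c\<^sub>1, \<dots>, c\<^sub>n)\<close>, in closed form \<open>c\<^sub>i = \<pi>\<^bsup>i-1\<^esup>(1)\<close>; the two
  lemmas below recover the defining recursion.\<close>

definition cycle_notation :: "nat \<Rightarrow> (nat \<Rightarrow> nat) \<Rightarrow> nat list" where
  "cycle_notation n \<pi> = map (\<lambda>i. (\<pi> ^^ i) 1) [0..<n]"

lemma cycle_notation_first: "0 < n \<Longrightarrow> cycle_notation n \<pi> ! 0 = 1"
  by (simp add: cycle_notation_def)

lemma cycle_notation_step:
  "Suc i < n \<Longrightarrow> cycle_notation n \<pi> ! Suc i = \<pi> (cycle_notation n \<pi> ! i)"
  by (simp add: cycle_notation_def)

text \<open>\<open>f\<close> is the increasing choice of positions \<open>i\<^sub>1 < \<dots> < i\<^sub>k\<close>.\<close>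

definition contains_pattern :: "nat list \<Rightarrow> nat list \<Rightarrow> bool" where
  "contains_pattern w \<sigma> \<longleftrightarrow>
     (\<exists>f :: nat \<Rightarrow> nat. strict_mono_on {..<length \<sigma>} f \<and> f ` {..<length \<sigma>} \<subseteq> {..<length w} \<and>
        (\<forall>a<length \<sigma>. \<forall>b<length \<sigma>. w ! f a < w ! f b \<longleftrightarrow> \<sigma> ! a < \<sigma> ! b))"

definition avoids :: "nat list \<Rightarrow> nat list \<Rightarrow> bool" where
  "avoids w \<sigma> \<longleftrightarrow> \<not> contains_pattern w \<sigma>"

definition avoiding_cyclic :: "nat \<Rightarrow> nat list \<Rightarrow> nat list \<Rightarrow> (nat \<Rightarrow> nat) set" where
  "avoiding_cyclic n \<sigma> \<tau> =
     {\<pi>. cyclic_perm n \<pi> \<and> avoids (one_line n \<pi>) \<sigma> \<and> avoids (cycle_notation n \<pi>) \<tau>}"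

lemma finite_avoiding_cyclic: "finite (avoiding_cyclic n \<sigma> \<tau>)"
  by (rule finite_subset[OF _ finite_permutations[of "{1..n}"]])
     (auto simp: avoiding_cyclic_def cyclic_perm_def)

definition num_avoiding_cyclic :: "nat \<Rightarrow> nat list \<Rightarrow> nat list \<Rightarrow> nat" where
  "num_avoiding_cyclic n \<sigma> \<tau> = card (avoiding_cyclic n \<sigma> \<tau>)"

end

theory Submission
  imports Defs
begin

text \<open>Let \<open>w\<close> be the last entry of \<open>C(\<pi>)\<close>, so that \<open>\<pi> w = 1\<close>. Avoiding 132 forces \<open>\<pi>\<close> to increase
  on the positions beyond \<open>w\<close>, and therefore \<open>\<pi> y < y\<close> there because \<open>\<pi>\<close> has no fixed point; avoiding
  213 forces the entries of \<open>C(\<pi>)\<close> up to \<open>w\<close> to appear in increasing order. Together these leave only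
  \<open>C(\<pi>) = (1, n, n - 1, \<dots>, w + 1, 2, 3, \<dots>, w)\<close>, and each \<open>w \<in> {2..n}\<close> does occur.\<close>

section \<open>Pattern avoidance as conditions on triples of positions\<close>

text \<open>Order isomorphism on three points reduces to the two inequalities between consecutive
  values, which for 132 sit at positions \<open>i\<close>, \<open>k\<close>, \<open>j\<close>. The
  choice function \<open>f\<close> is just this triple.\<close>

lemma avoids_132_iff:
  "avoids xs [1, 3, 2] \<longleftrightarrow>
    (\<forall>i j k. i < j \<longrightarrow> j < k \<longrightarrow> k < length xs \<longrightarrow> \<not> (xs ! i < xs ! k \<and> xs ! k < xs ! j))"
    (is "_ \<longleftrightarrow> ?R")
proof
  assume av: "avoids xs [1, 3, 2]"
  show ?R
  proof (intro allI impI notI)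
    fix i j k
    assume *: "i < j" "j < k" "k < length xs" "xs ! i < xs ! k \<and> xs ! k < xs ! j"
    let ?f = "\<lambda>a::nat. if a = 0 then i else if a = 1 then j else k"
    have "contains_pattern xs [1, 3, 2]"
      unfolding contains_pattern_def
      by (rule exI[of _ ?f]) (use * in \<open>auto simp: strict_mono_on_def less_Suc_eq numeral_3_eq_3\<close>)
    with av show False by (simp add: avoids_def)
  qed
next
  assume R: ?R
  show "avoids xs [1, 3, 2]"
    unfolding avoids_def
  proof
    assume "contains_pattern xs [1, 3, 2]"
    then obtain f where f: "strict_mono_on {..<3::nat} f" "f ` {..<3} \<subseteq> {..<length xs}"
      "\<forall>a<3. \<forall>b<3. xs ! f a < xs ! f b \<longleftrightarrow> [1, 3, 2::nat] ! a < [1, 3, 2] ! b"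
      by (auto simp: contains_pattern_def numeral_3_eq_3)
    have "f 0 < f 1" "f 1 < f 2" using f(1) by (auto simp: strict_mono_on_def)
    moreover have "f 2 < length xs" using f(2) by (simp add: image_subset_iff)
    moreover have "xs ! f 0 < xs ! f 2" "xs ! f 2 < xs ! f 1" using f(3) by auto
    ultimately show False using R by blast
  qed
qed

lemma avoids_213_iff:
  "avoids xs [2, 1, 3] \<longleftrightarrow>
    (\<forall>i j k. i < j \<longrightarrow> j < k \<longrightarrow> k < length xs \<longrightarrow> \<not> (xs ! j < xs ! i \<and> xs ! i < xs ! k))"
    (is "_ \<longleftrightarrow> ?R")
proof
  assume av: "avoids xs [2, 1, 3]"
  show ?R
  proof (intro allI impI notI)
    fix i j k
    assume *: "i < j" "j < k" "k < length xs" "xs ! j < xs ! i \<and> xs ! i < xs ! k"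
    let ?f = "\<lambda>a::nat. if a = 0 then i else if a = 1 then j else k"
    have "contains_pattern xs [2, 1, 3]"
      unfolding contains_pattern_def
      by (rule exI[of _ ?f]) (use * in \<open>auto simp: strict_mono_on_def less_Suc_eq numeral_3_eq_3\<close>)
    with av show False by (simp add: avoids_def)
  qed
next
  assume R: ?R
  show "avoids xs [2, 1, 3]"
    unfolding avoids_def
  proof
    assume "contains_pattern xs [2, 1, 3]"
    then obtain f where f: "strict_mono_on {..<3::nat} f" "f ` {..<3} \<subseteq> {..<length xs}"
      "\<forall>a<3. \<forall>b<3. xs ! f a < xs ! f b \<longleftrightarrow> [2, 1, 3::nat] ! a < [2, 1, 3] ! b"
      by (auto simp: contains_pattern_def numeral_3_eq_3)
    have "f 0 < f 1" "f 1 < f 2" using f(1) by (auto simp: strict_mono_on_def)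
    moreover have "f 2 < length xs" using f(2) by (simp add: image_subset_iff)
    moreover have "xs ! f 1 < xs ! f 0" "xs ! f 0 < xs ! f 2" using f(3) by auto
    ultimately show False using R by blast
  qed
qed

text \<open>List indices shift by one here, so that the condition speaks of arguments of
  \<open>\<pi>\<close>.\<close>

lemma avoids_one_line_132_iff:
  "avoids (one_line n \<pi>) [1, 3, 2] \<longleftrightarrow>
    (\<forall>i j k. 1 \<le> i \<longrightarrow> i < j \<longrightarrow> j < k \<longrightarrow> k \<le> n \<longrightarrow> \<not> (\<pi> i < \<pi> k \<and> \<pi> k < \<pi> j))"
    (is "_ \<longleftrightarrow> ?R")
proof -
  have nth: "one_line n \<pi> ! i = \<pi> (Suc i)" if "i < n" for i
    using that by (simp add: one_line_def nth_append del: upt_Suc)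
  have len: "length (one_line n \<pi>) = n" by (simp add: one_line_def)
  show ?thesis
    unfolding avoids_132_iff len
  proof (intro iffI allI impI)
    fix i j k
    assume H: "\<forall>i j k. i < j \<longrightarrow> j < k \<longrightarrow> k < n \<longrightarrow>
        \<not> (one_line n \<pi> ! i < one_line n \<pi> ! k \<and> one_line n \<pi> ! k < one_line n \<pi> ! j)"
      and "1 \<le> i" "i < j" "j < k" "k \<le> n"
    then show "\<not> (\<pi> i < \<pi> k \<and> \<pi> k < \<pi> j)"
      using H[rule_format, of "i - 1" "j - 1" "k - 1"] by (simp add: nth)
  next
    fix i j k
    assume H: ?R and "i < j" "j < k" "k < n"
    then show "\<not> (one_line n \<pi> ! i < one_line n \<pi> ! k \<and> one_line n \<pi> ! k < one_line n \<pi> ! j)"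
      using H[rule_format, of "Suc i" "Suc j" "Suc k"] by (simp add: nth)
  qed
qed

lemma avoids_cycle_notation_213_iff:
  "avoids (cycle_notation n \<pi>) [2, 1, 3] \<longleftrightarrow>
    (\<forall>i j k. i < j \<longrightarrow> j < k \<longrightarrow> k < n \<longrightarrow>
      \<not> ((\<pi> ^^ j) 1 < (\<pi> ^^ i) 1 \<and> (\<pi> ^^ i) 1 < (\<pi> ^^ k) 1))"
  unfolding avoids_213_iff by (auto simp: cycle_notation_def)

text \<open>The iterates of 1 before its first return list its orbit without repetition. The orbit
  is all of \<open>{1..n}\<close>, so comparing cardinalities shows that the return time
  \<open>?d\<close> is \<open>n\<close>.\<close>

lemma cyclic_perm_bij_betw_funpow:
  assumes "cyclic_perm n \<pi>" "0 < n"
  shows "bij_betw (\<lambda>i. (\<pi> ^^ i) 1) {..<n} {1..n}" and "(\<pi> ^^ n) 1 = 1"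
proof -
  have cyc: "cyclic_on \<pi> {1..n}" using assms by (simp add: cyclic_perm_def)
  have orb: "orbit \<pi> 1 = {1..n}"
    using cyc assms(2) by (intro orbit_cyclic_eq3) auto
  then have self: "1 \<in> orbit \<pi> 1" using assms(2) by auto
  let ?d = "funpow_dist1 \<pi> 1 1"
  have bij: "bij_betw (\<lambda>i. (\<pi> ^^ i) 1) {0..<?d} {1..n}"
    using inj_on_funpow_dist1[OF self] orbit_conv_funpow_dist1[OF self] orb
    by (simp add: bij_betw_def)
  have d: "?d = n" using bij_betw_same_card[OF bij] by simp
  show "bij_betw (\<lambda>i. (\<pi> ^^ i) 1) {..<n} {1..n}" using bij d by (simp add: lessThan_atLeast0)
  show "(\<pi> ^^ n) 1 = 1" using funpow_dist1_prop[OF self] unfolding d .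
qed

section \<open>The candidate permutations, one for each \<open>w\<close>\<close>

text \<open>Entry \<open>i\<close>, counted from 0, of the cycle (1, n, n - 1, ..., w + 1, 2, 3,
  ..., w). The descending block fills positions 1 to \<open>n - w\<close> and is empty for
  \<open>w = n\<close>.\<close>

definition wit_cycle :: "nat \<Rightarrow> nat \<Rightarrow> nat \<Rightarrow> nat" where
  "wit_cycle n w i = (if i = 0 then 1 else if i \<le> n - w then n + 1 - i else i - (n - w) + 1)"

text \<open>In one-line notation: n, 3, 4, ..., w, 1, 2, w + 1, ..., n - 1 if \<open>w < n\<close>,
  and 2, 3, ..., n, 1 if \<open>w = n\<close>, where 1 is followed directly by 2. Points outside
  \<open>{1..n}\<close> are fixed, as \<open>permutes\<close> demands.\<close>

definition wit_perm :: "nat \<Rightarrow> nat \<Rightarrow> nat \<Rightarrow> nat" where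
  "wit_perm n w x =
    (if x = 0 \<or> x > n then x else if x = w then 1
     else if x = 1 then (if w = n then 2 else n)
     else if x < w then x + 1 else if x = w + 1 then 2 else x - 1)"

lemma wit_perm_cycle_step:
  assumes "2 \<le> w" "w \<le> n" "Suc i < n"
  shows "wit_perm n w (wit_cycle n w i) = wit_cycle n w (Suc i)"
proof -
  consider "i = 0" | "1 \<le> i" "i < n - w" | "1 \<le> i" "i = n - w" | "1 \<le> i" "n - w < i" by linarith
  then show ?thesis
  proof cases
    case 1
    then show ?thesis using assms by (auto simp: wit_perm_def wit_cycle_def)
  next
    case 2
    then have "wit_cycle n w i = n + 1 - i" "wit_cycle n w (Suc i) = n - i"
      by (simp_all add: wit_cycle_def)
    moreover have "w + 1 < n + 1 - i" using 2 by simp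
    ultimately show ?thesis using 2 assms(1) by (simp add: wit_perm_def)
  next
    \<comment> \<open>The junction: the descending block ends at \<open>w + 1\<close> and the
      increasing block begins at 2.\<close>
    case 3
    then have "wit_cycle n w i = w + 1" "wit_cycle n w (Suc i) = 2"
      using assms by (simp_all add: wit_cycle_def)
    moreover have "w < n" using 3 by simp
    ultimately show ?thesis using assms(1) by (simp add: wit_perm_def)
  next
    case 4
    define y where "y = i - (n - w) + 1"
    have "wit_cycle n w i = y" "wit_cycle n w (Suc i) = y + 1"
      using 4 by (simp_all add: wit_cycle_def y_def)
    moreover have "2 \<le> y" "y < w" using 4 assms by (simp_all add: y_def)
    ultimately show ?thesis using assms(2) by (simp add: wit_perm_def)
  qed
qed

lemma wit_cycle_last:
  assumes "2 \<le> w" "w \<le> n"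
  shows "wit_cycle n w (n - 1) = w"
  using assms unfolding wit_cycle_def by auto

lemma funpow_wit_perm:
  assumes "2 \<le> w" "w \<le> n" "i < n"
  shows "(wit_perm n w ^^ i) 1 = wit_cycle n w i"
  using assms(3)
proof (induction i)
  case 0
  then show ?case by (simp add: wit_cycle_def)
next
  case (Suc i)
  then show ?case using wit_perm_cycle_step[OF assms(1,2), of i] by simp
qed

text \<open>The three positions supplied invert the three branches of
  \<open>wit_cycle\<close>.\<close>

lemma wit_cycle_surj:
  assumes "2 \<le> w" "w \<le> n" "1 \<le> x" "x \<le> n"
  shows "\<exists>i<n. wit_cycle n w i = x"
proof -
  consider "x = 1" | "w < x" | "2 \<le> x" "x \<le> w" using assms by linarith
  then show ?thesis
  proof cases
    case 1
    then show ?thesis using assms by (intro exI[of _ 0]) (auto simp: wit_cycle_def)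
  next
    case 2
    then show ?thesis using assms by (intro exI[of _ "n + 1 - x"]) (auto simp: wit_cycle_def)
  next
    case 3
    then show ?thesis using assms by (intro exI[of _ "x - 1 + (n - w)"]) (auto simp: wit_cycle_def)
  qed
qed

text \<open>A surjection of a finite set onto itself is injective. The preimage of an entry is its
  predecessor in the cycle; for the entry 1 it is \<open>w\<close>.\<close>

lemma wit_perm_permutes:
  assumes "2 \<le> w" "w \<le> n"
  shows "wit_perm n w permutes {1..n}"
proof (rule bij_imp_permutes)
  have "{1..n} \<subseteq> wit_perm n w ` {1..n}"
  proof
    fix x
    assume "x \<in> {1..n}"
    then obtain i where i: "i < n" "wit_cycle n w i = x" using wit_cycle_surj[OF assms, of x] by auto
    show "x \<in> wit_perm n w ` {1..n}"
    proof (cases i)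
      case 0
      then have "x = wit_perm n w w" using i assms by (simp add: wit_cycle_def wit_perm_def)
      then show ?thesis using assms by (intro image_eqI[of _ _ w]) auto
    next
      case (Suc j)
      have "wit_cycle n w j \<in> {1..n}" using Suc i by (auto simp: wit_cycle_def)
      moreover have "x = wit_perm n w (wit_cycle n w j)"
        using wit_perm_cycle_step[OF assms, of j] i Suc by simp
      ultimately show ?thesis by blast
    qed
  qed
  moreover have "wit_perm n w ` {1..n} \<subseteq> {1..n}"
  proof
    fix y
    assume "y \<in> wit_perm n w ` {1..n}"
    then obtain x where "1 \<le> x" "x \<le> n" "y = wit_perm n w x" by auto
    then show "y \<in> {1..n}" using assms by (auto simp: wit_perm_def)
  qed
  ultimately have "wit_perm n w ` {1..n} = {1..n}" by blast
  then show "bij_betw (wit_perm n w) {1..n} {1..n}"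
    by (simp add: bij_betw_def eq_card_imp_inj_on)
next
  show "wit_perm n w x = x" if "x \<notin> {1..n}" for x
    using that by (auto simp: wit_perm_def)
qed

lemma wit_perm_cyclic:
  assumes "2 \<le> w" "w \<le> n"
  shows "cyclic_perm n (wit_perm n w)"
proof -
  let ?p = "wit_perm n w"
  have "?p ((?p ^^ (n - 1)) 1) = 1"
    using funpow_wit_perm[OF assms, of "n - 1"] wit_cycle_last[OF assms] assms
    by (simp add: wit_perm_def)
  then have "(?p ^^ Suc (n - 1)) 1 = 1" by simp
  then have "(?p ^^ n) 1 = 1" using assms by simp
  then have orb: "orbit ?p 1 = {(?p ^^ m) 1 | m. m < n}"
    by (rule orbit_altdef_bounded) (use assms in simp)
  have "{1..n} \<subseteq> orbit ?p 1"
  proof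
    fix x
    assume "x \<in> {1..n}"
    then obtain i where "i < n" "wit_cycle n w i = x" using wit_cycle_surj[OF assms, of x] by auto
    then show "x \<in> orbit ?p 1" unfolding orb using funpow_wit_perm[OF assms, of i] by force
  qed
  moreover have "orbit ?p 1 \<subseteq> {1..n}"
    using wit_perm_permutes[OF assms] assms by (intro permutes_orbit_subset) auto
  ultimately have "cyclic_on ?p {1..n}"
    using assms by (intro cyclic_on_singleI[of 1]) auto
  then show ?thesis using wit_perm_permutes[OF assms] by (simp add: cyclic_perm_def)
qed

text \<open>Position \<open>b\<close> would carry the 3. Left of \<open>w\<close>, every later value
  is at most 2 or at least \<open>?p b\<close>, while \<open>?p a\<close> is already at least 2; at
  \<open>w\<close> the value is 1; right of \<open>w\<close> the values increase.\<close>

lemma wit_perm_avoids_132: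
  assumes "2 \<le> w" "w \<le> n"
  shows "avoids (one_line n (wit_perm n w)) [1, 3, 2]"
  unfolding avoids_one_line_132_iff
proof (intro allI impI notI)
  fix a b d
  let ?p = "wit_perm n w"
  assume le: "1 \<le> a" "a < b" "b < d" "d \<le> n" and less: "?p a < ?p d \<and> ?p d < ?p b"
  consider "b < w" | "b = w" | "w < b" by linarith
  then show False
  proof cases
    case 1
    have "2 \<le> ?p a" using le 1 by (simp add: wit_perm_def)
    moreover have "?p b = b + 1" using le 1 assms by (simp add: wit_perm_def)
    moreover have "?p d \<le> 2 \<or> b + 1 \<le> ?p d" using le 1 by (auto simp: wit_perm_def)
    ultimately show False using less by linarith
  next
    case 2
    then have "?p b = 1" using assms by (simp add: wit_perm_def)
    then show False using less by simp
  next
    case 3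
    then have "?p b < ?p d" using le assms by (auto simp: wit_perm_def)
    then show False using less by simp
  qed
qed

text \<open>Position \<open>i\<close> would carry the 2. The initial 1 has nothing below it, an
  entry of the descending block has nothing larger after it, and an entry of the increasing block
  has nothing smaller after it.\<close>

lemma wit_perm_avoids_213:
  assumes "2 \<le> w" "w \<le> n"
  shows "avoids (cycle_notation n (wit_perm n w)) [2, 1, 3]"
  unfolding avoids_cycle_notation_213_iff
proof (intro allI impI)
  fix i j k
  let ?c = "wit_cycle n w"
  assume le: "i < j" "j < k" "k < n"
  have "\<not> (?c j < ?c i \<and> ?c i < ?c k)"
  proof
    assume less: "?c j < ?c i \<and> ?c i < ?c k"
    consider "i = 0" | "1 \<le> i" "i \<le> n - w" | "n - w < i" by linarith
    then show False
    proof cases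
      case 1
      then have "?c i \<le> ?c j" using le by (auto simp: wit_cycle_def)
      then show False using less by simp
    next
      case 2
      then have "?c k < ?c i" using le assms by (auto simp: wit_cycle_def)
      then show False using less by simp
    next
      case 3
      then have "?c i < ?c j" using le by (simp add: wit_cycle_def)
      then show False using less by simp
    qed
  qed
  then show "\<not> ((wit_perm n w ^^ j) 1 < (wit_perm n w ^^ i) 1
      \<and> (wit_perm n w ^^ i) 1 < (wit_perm n w ^^ k) 1)"
    using funpow_wit_perm[OF assms, of i] funpow_wit_perm[OF assms, of j]
      funpow_wit_perm[OF assms, of k] le by simp
qed

lemma wit_perm_mem:
  assumes "2 \<le> w" "w \<le> n"
  shows "wit_perm n w \<in> avoiding_cyclic n [1, 3, 2] [2, 1, 3]"
  unfolding avoiding_cyclic_def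
  using wit_perm_cyclic[OF assms] wit_perm_avoids_132[OF assms] wit_perm_avoids_213[OF assms] by blast

section \<open>Reconstruction of the cycle from the two avoidance conditions\<close>

text \<open>Cyclicity is recorded by \<open>c\<close>, which visits each element of
  \<open>{1..n}\<close> once before returning to 1.\<close>

locale avoider =
  fixes n :: nat and \<pi> :: "nat \<Rightarrow> nat" and c :: "nat \<Rightarrow> nat"
  assumes n: "2 \<le> n"
    and perm: "\<pi> permutes {1..n}"
    and bij: "bij_betw c {..<n} {1..n}"
    and c0 [simp]: "c 0 = 1"
    and c_Suc: "\<And>i. c (Suc i) = \<pi> (c i)"
    and c_n: "c n = 1"
    and no132: "\<And>i j k. 1 \<le> i \<Longrightarrow> i < j \<Longrightarrow> j < k \<Longrightarrow> k \<le> n \<Longrightarrow> \<pi> i < \<pi> k \<Longrightarrow> \<pi> k < \<pi> j \<Longrightarrow> False"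
    and no213: "\<And>i j k. i < j \<Longrightarrow> j < k \<Longrightarrow> k < n \<Longrightarrow> c j < c i \<Longrightarrow> c i < c k \<Longrightarrow> False"
begin

definition w :: nat where "w = c (n - 1)"

lemma c_inj: "i < n \<Longrightarrow> j < n \<Longrightarrow> c i = c j \<longleftrightarrow> i = j"
  using bij by (auto simp: bij_betw_def inj_on_def)

lemma c_bounds: "i < n \<Longrightarrow> 1 \<le> c i" "i < n \<Longrightarrow> c i \<le> n"
  using bij by (auto simp: bij_betw_def)

lemma c_surj:
  assumes "1 \<le> x" "x \<le> n"
  obtains i where "i < n" "c i = x"
  using bij assms unfolding bij_betw_def by (metis atLeastAtMost_iff imageE lessThan_iff)

lemma pi_inj: "\<pi> x = \<pi> y \<longleftrightarrow> x = y"
  using permutes_inj[OF perm] by (auto dest: injD)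

lemma pi_bounds: "1 \<le> x \<Longrightarrow> x \<le> n \<Longrightarrow> 1 \<le> \<pi> x" "1 \<le> x \<Longrightarrow> x \<le> n \<Longrightarrow> \<pi> x \<le> n"
  using permutes_in_image[OF perm, of x] by auto

lemma pi_w: "\<pi> w = 1"
  using c_Suc[of "n - 1"] c_n n by (simp add: w_def)

lemma w_bounds: "2 \<le> w" "w \<le> n"
proof -
  have "c (n - 1) \<noteq> c 0" using c_inj[of "n - 1" 0] n by simp
  then show "2 \<le> w" "w \<le> n" using c_bounds[of "n - 1"] n by (auto simp: w_def)
qed

lemma pi_gt_1: "1 \<le> x \<Longrightarrow> x \<le> n \<Longrightarrow> x \<noteq> w \<Longrightarrow> 2 \<le> \<pi> x"
  using pi_inj[of x w] pi_w pi_bounds(1)[of x] by linarith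

text \<open>A descent beyond \<open>w\<close>, preceded by the value 1 at \<open>w\<close>, would be
  a 132.\<close>

lemma pi_mono_beyond_w:
  assumes "w < y" "y < z" "z \<le> n"
  shows "\<pi> y < \<pi> z"
proof (rule ccontr)
  assume "\<not> \<pi> y < \<pi> z"
  then have "\<pi> z < \<pi> y" using pi_inj[of y z] assms by linarith
  then show False using no132[of w y z] pi_w pi_gt_1[of z] w_bounds assms by simp
qed

text \<open>Strict increase propagates \<open>\<pi> n \<le> n\<close> downwards to
  \<open>\<pi> y \<le> y\<close>. Equality would make two neighbouring entries of the cycle
  coincide.\<close>

lemma pi_less:
  assumes "w < y" "y \<le> n"
  shows "\<pi> y < y"
proof -
  have "\<pi> y \<le> y"
    using assms(2) assms(1)
  proof (induction rule: inc_induct)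
    case base
    then show ?case using pi_bounds[of n] n by simp
  next
    case (step y)
    then show ?case using pi_mono_beyond_w[of y "Suc y"] by simp
  qed
  moreover have "\<pi> y \<noteq> y"
  proof
    assume fixed: "\<pi> y = y"
    obtain i where i: "i < n" "c i = y" using c_surj[of y] assms w_bounds by auto
    then have "i \<noteq> n - 1" using assms by (auto simp: w_def)
    then have "Suc i < n" using i by simp
    then show False using c_inj[of "Suc i" i] c_Suc[of i] fixed i by simp
  qed
  ultimately show ?thesis by simp
qed

text \<open>A decrease among entries up to \<open>w\<close>, followed by the final entry
  \<open>w\<close>, would be a 213.\<close>

lemma c_mono_upto_w:
  assumes "i < j" "j < n" "c i \<le> w" "c j \<le> w"
  shows "c i < c j"
proof (rule ccontr)
  assume "\<not> c i < c j"
  moreover have "c i \<noteq> c j" using c_inj[of i j] assms by simp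
  ultimately have less: "c j < c i" by simp
  moreover have "c i \<noteq> w" using c_inj[of i "n - 1"] assms by (simp add: w_def)
  ultimately have "j \<noteq> n - 1" using assms by (auto simp: w_def)
  then show False
    using no213[of i j "n - 1"] less \<open>c i \<noteq> w\<close> assms unfolding w_def by linarith
qed

text \<open>Entries up to \<open>w\<close> appear in increasing order and 1 stands at position 0, so
  the next of them is 2.\<close>

lemma first_small_eq_2:
  assumes "1 \<le> j" "j < n" "c j \<le> w" "\<And>i. 1 \<le> i \<Longrightarrow> i < j \<Longrightarrow> w < c i"
  shows "c j = 2"
proof -
  obtain k where k: "k < n" "c k = 2" using c_surj[of 2] n by auto
  have "k \<noteq> 0" using k by (cases k) auto
  have "\<not> k < j" using assms(4)[of k] k \<open>k \<noteq> 0\<close> w_bounds by auto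
  moreover have "\<not> j < k"
  proof
    assume "j < k"
    then have "c j < 2" using c_mono_upto_w[of j k] k assms w_bounds by simp
    then show False using c_bounds(1)[of j] c_inj[of j 0] assms by simp
  qed
  ultimately show ?thesis using k by (simp add: linorder_neq_iff[symmetric])
qed

text \<open>Otherwise \<open>n\<close> comes later, at position \<open>p\<close>. Its predecessor
  \<open>c q\<close> is at most \<open>w\<close>, since \<open>\<pi>\<close> lowers everything
  beyond \<open>w\<close>; each pattern then excludes part of what remains.\<close>

lemma c_1_eq_n:
  assumes "w < n"
  shows "c 1 = n"
proof (rule ccontr)
  assume neq: "c 1 \<noteq> n"
  obtain p where p: "p < n" "c p = n" using c_surj[of n] n by auto
  have "p \<noteq> 0" "p \<noteq> 1" using p n neq by (auto intro: gr0I)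
  then obtain q where q: "p = Suc q" "1 \<le> q" by (cases p) auto
  have pi_q: "\<pi> (c q) = n" using c_Suc[of q] q p by simp
  have cq_n: "c q \<noteq> n" using c_inj[of q p] p q by simp
  have cq_w: "c q \<le> w"
    using pi_less[of "c q"] c_bounds[of q] pi_q p q by (metis Suc_lessD leI not_le)
  have cq_1: "c q \<noteq> 1" using c_inj[of q 0] q p by simp
  have m: "\<pi> 1 = c 1" using c_Suc[of 0] by simp
  have m_n: "c 1 < n" using neq c_bounds[of 1] n by simp
  have "\<pi> n < n" using pi_less assms by simp
  \<comment> \<open>Otherwise \<open>\<pi>\<close> takes the values \<open>c 1\<close>,
    \<open>n\<close>, \<open>\<pi> n\<close> at 1, \<open>c q\<close>, \<open>n\<close>, which is a
    132.\<close>
  have "\<not> c 1 < \<pi> n"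
    using no132[of 1 "c q" n] m pi_q \<open>\<pi> n < n\<close> cq_1 cq_n c_bounds[of q] p q by auto
  then have pi_n: "\<pi> n < c 1" using pi_inj[of n 1] m n by simp
  show False
  \<comment> \<open>A small \<open>c 1\<close> equals 2, leaving only 1 for \<open>\<pi> n\<close>,
    yet 1 is taken at \<open>w\<close>. A large \<open>c 1\<close> gives the 213 formed by
    \<open>c 1\<close>, \<open>c q\<close>, \<open>n\<close>.\<close>
  proof (cases "c 1 \<le> w")
    case True
    then have "c 1 = 2" using first_small_eq_2[of 1] n by simp
    then show False using pi_n pi_gt_1[of n] n assms by simp
  next
    case False
    then have "q \<noteq> 1" using cq_w by auto
    then show False
      using no213[of 1 q p] q p cq_w False m_n by simp
  qed
qed

lemma c_descent:
  assumes "1 \<le> k" "k \<le> n - w"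
  shows "c k = n + 1 - k"
  using assms
proof (induction k rule: less_induct)
  case (less k)
  have wn: "w < n" using less.prems by simp
  show ?case
  proof (cases "k = 1")
    case True
    then show ?thesis using c_1_eq_n wn by simp
  next
    case False
    then obtain l where l: "k = Suc l" "1 \<le> l" using less.prems by (cases k) auto
    have IH: "c i = n + 1 - i" if "1 \<le> i" "i \<le> l" for i
      using less.IH[of i] less.prems that l by simp
    define z where "z = n - l"
    have z: "w < z" "z < n" using less.prems l by (auto simp: z_def)
    have cl: "c l = Suc z" using IH[of l] l z by (simp add: z_def)
    have ck: "c k = \<pi> (Suc z)" using c_Suc[of l] l cl by simp
    have k_n: "k < n" using less.prems w_bounds by simp
    have "c k = z"
    proof (rule ccontr)
      assume "c k \<noteq> z"
      then have x: "c k < z" using pi_less[of "Suc z"] ck z by simp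
      obtain p where p: "p < n" "c p = z" using c_surj[of z] z w_bounds by auto
      have "p \<noteq> 0" using p z w_bounds by (auto intro: gr0I)
      moreover have "p \<noteq> k" using x p by auto
      moreover have "\<not> p \<le> l" using IH[of p] p \<open>p \<noteq> 0\<close> l k_n by (auto simp: z_def)
      ultimately have "k < p" using l by simp
      then obtain q where q: "p = Suc q" "k \<le> q" by (cases p) auto
      have pi_q: "\<pi> (c q) = z" using c_Suc[of q] q p by simp
      \<comment> \<open>By \<open>pi_less\<close>, a predecessor beyond \<open>w\<close> would
        exceed \<open>z\<close>, but the values above \<open>z\<close> already occupy positions 1 to
        \<open>l\<close>.\<close>
      have cq: "c q \<le> w"
      proof (rule ccontr)
        assume "\<not> c q \<le> w"
        then have "z < c q" "c q \<le> n" using pi_less[of "c q"] c_bounds[of q] pi_q p q by auto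
        then have "c (n + 1 - c q) = c q" using IH[of "n + 1 - c q"] z by (auto simp: z_def)
        then have "n + 1 - c q = q"
          using c_inj[of "n + 1 - c q" q] p q \<open>z < c q\<close> z by simp
        then show False using q l \<open>z < c q\<close> z by (auto simp: z_def)
      qed
      have pi_z: "\<pi> z < c k" using pi_mono_beyond_w[of z "Suc z"] ck z by simp
      show False
      proof (cases "c k \<le> w")
        case True
        have "c k = 2"
        proof (rule first_small_eq_2[OF _ k_n True])
          show "w < c i" if "1 \<le> i" "i < k" for i
            using IH[of i] that l less.prems by simp
        qed (use less.prems in simp)
        then show False using pi_z pi_gt_1[of z] z w_bounds by simp
      next
        case False
        then have "q \<noteq> k" using cq by auto
        then show False using no213[of k q p] q p cq False x by simp
      qed
    qed
    then show ?thesis using l by (simp add: z_def)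
  qed
qed

text \<open>By \<open>c_descent\<close> all values above \<open>w\<close> are used up at positions 1
  to \<open>n - w\<close>.\<close>

lemma c_tail_le_w:
  assumes "n - w < i" "i < n"
  shows "c i \<le> w"
proof (rule ccontr)
  assume "\<not> c i \<le> w"
  then have "c (n + 1 - c i) = c i"
    using c_descent[of "n + 1 - c i"] c_bounds[of i] assms by simp
  then have "n + 1 - c i = i"
    using c_inj[of "n + 1 - c i" i] assms \<open>\<not> c i \<le> w\<close> w_bounds by simp
  then show False using \<open>\<not> c i \<le> w\<close> assms by simp
qed

text \<open>The tail is strictly increasing and its first entry is at least 2. Counting up from
  there gives this bound; counting back from the final entry \<open>w\<close> gives the matching
  \<open>c_tail_le\<close>.\<close>

lemma c_tail_ge:
  assumes "Suc (n - w + j) < n"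
  shows "j + 2 \<le> c (Suc (n - w + j))"
  using assms
proof (induction j)
  case 0
  then show ?case
    using c_bounds(1)[of "Suc (n - w)"] c_inj[of "Suc (n - w)" 0] by simp
next
  case (Suc j)
  then show ?case
    using c_mono_upto_w[of "Suc (n - w + j)" "Suc (n - w + Suc j)"]
      c_tail_le_w[of "Suc (n - w + j)"] c_tail_le_w[of "Suc (n - w + Suc j)"] by simp
qed

lemma c_tail_le:
  assumes "n - w < n - 1 - t" "1 \<le> n - t"
  shows "c (n - 1 - t) + t \<le> w"
  using assms
proof (induction t)
  case 0
  then show ?case by (simp add: w_def)
next
  case (Suc t)
  have "c (n - 1 - Suc t) < c (n - 1 - t)"
    using Suc.prems by (intro c_mono_upto_w c_tail_le_w) auto
  moreover have "c (n - 1 - t) + t \<le> w" using Suc.prems by (intro Suc.IH) auto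
  ultimately show ?case by linarith
qed

lemma c_eq_wit_cycle:
  assumes "i < n"
  shows "c i = wit_cycle n w i"
proof -
  consider "i = 0" | "1 \<le> i" "i \<le> n - w" | "n - w < i" by linarith
  then show ?thesis
  proof cases
    case 3
    \<comment> \<open>The bounds counted from the two ends of the tail coincide.\<close>
    have "i - (n - w) + 1 \<le> c i" using c_tail_ge[of "i - (n - w) - 1"] 3 assms by simp
    moreover have "c i \<le> i - (n - w) + 1"
      using c_tail_le[of "n - 1 - i"] 3 assms w_bounds by simp
    ultimately show ?thesis using 3 by (simp add: wit_cycle_def)
  qed (auto simp: wit_cycle_def c_descent)
qed

text \<open>The cycle determines \<open>\<pi>\<close> on \<open>{1..n}\<close>: each entry goes to
  the next one and the last, \<open>w\<close>, to 1.\<close>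

lemma pi_eq_wit_perm: "\<pi> = wit_perm n w"
proof
  fix x
  show "\<pi> x = wit_perm n w x"
  proof (cases "1 \<le> x \<and> x \<le> n")
    case True
    then obtain i where i: "i < n" "c i = x" using c_surj by blast
    show ?thesis
    proof (cases "Suc i < n")
      case True
      then show ?thesis
        using wit_perm_cycle_step[OF w_bounds True] c_eq_wit_cycle i c_Suc[of i] by simp
    next
      case False
      then have "i = n - 1" using i by simp
      then have "x = w" using i by (simp add: w_def)
      then show ?thesis using pi_w w_bounds by (simp add: wit_perm_def)
    qed
  next
    case False
    then have "\<pi> x = x" using perm by (simp add: permutes_def)
    then show ?thesis using False by (auto simp: wit_perm_def)
  qed
qed

end

section \<open>Classification and count\<close>

lemma avoiding_cyclic_132_213_eq:
  assumes "2 \<le> n"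
  shows "avoiding_cyclic n [1, 3, 2] [2, 1, 3] = wit_perm n ` {2..n}"
proof (intro equalityI subsetI)
  fix \<pi>
  assume \<pi>: "\<pi> \<in> avoiding_cyclic n [1, 3, 2] [2, 1, 3]"
  then have cyc: "cyclic_perm n \<pi>" by (simp add: avoiding_cyclic_def)
  interpret avoider n \<pi> "\<lambda>i. (\<pi> ^^ i) 1"
  proof
    show "\<pi> permutes {1..n}" using cyc by (simp add: cyclic_perm_def)
    show "bij_betw (\<lambda>i. (\<pi> ^^ i) 1) {..<n} {1..n}" "(\<pi> ^^ n) 1 = 1"
      using cyclic_perm_bij_betw_funpow[OF cyc] assms by auto
    show False
      if "1 \<le> i" "i < j" "j < k" "k \<le> n" "\<pi> i < \<pi> k" "\<pi> k < \<pi> j" for i j k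
      using \<pi> that unfolding avoiding_cyclic_def avoids_one_line_132_iff by blast
    show False
      if "i < j" "j < k" "k < n" "(\<pi> ^^ j) 1 < (\<pi> ^^ i) 1" "(\<pi> ^^ i) 1 < (\<pi> ^^ k) 1" for i j k
      using \<pi> that unfolding avoiding_cyclic_def avoids_cycle_notation_213_iff by blast
  qed (use assms in simp_all)
  show "\<pi> \<in> wit_perm n ` {2..n}"
    using pi_eq_wit_perm w_bounds by auto
next
  fix \<pi>
  assume "\<pi> \<in> wit_perm n ` {2..n}"
  then obtain u where "2 \<le> u" "u \<le> n" "\<pi> = wit_perm n u" by auto
  then show "\<pi> \<in> avoiding_cyclic n [1, 3, 2] [2, 1, 3]" using wit_perm_mem by blast
qed

theorem theorem3p8:
  fixes n :: nat
  assumes "n \<ge> 2"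
  shows "num_avoiding_cyclic n [1, 3, 2] [2, 1, 3] = n - 1"
proof -
  have "inj_on (wit_perm n) {2..n}"
  proof (rule inj_onI)
    fix u v
    assume u: "u \<in> {2..n}" and v: "v \<in> {2..n}" and eq: "wit_perm n u = wit_perm n v"
    \<comment> \<open>The parameter is recovered as the only point mapped to 1.\<close>
    have "wit_perm n v u = 1" using u fun_cong[OF eq, of u] by (simp add: wit_perm_def)
    then show "u = v" using u v by (auto simp: wit_perm_def split: if_splits)
  qed
  then show ?thesis
    unfolding num_avoiding_cyclic_def avoiding_cyclic_132_213_eq[OF assms] by (simp add: card_image)
qed

end
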